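(* Let $g:\mathbb{R}^n\to\mathbb{R}$ be strongly convex, let $F:2^{[n]}\to\mathbb{R}$ be submodular with $F(\emptyset)=0$ and Lovász extension $f$, and let $p^\star=\min_{x\in\mathbb{R}^n}\,g(x)+f(x)$. For every tolerance $\epsilon\ge 0$, the algorithm L-KM on $(g,F,\epsilon)$ terminates after finitely many iterations. Moreover, if it terminates at iteration $i=i_\epsilon$, then $p^\star+\epsilon\ge p^{(i_\epsilon)}\ge p^\star$ and $p^\star\ge d^{(i_\epsilon)}\ge p^\star-\epsilon$. In particular, for $\epsilon=0$ one has $p^{(i_0)}=p^\star=d^{(i_0)}$, and $x^{(i_0)}$ is the unique minimizer of $g+f$ over $\mathbb{R}^n$.
   Context: $[n]=\{1,\dots,n\}$. $F:2^{[n]}\to\mathbb{R}$ is submodular if $F(A)+F(B)\ge F(A\cup B)+F(A\cap B)$ for all $A,B\subseteq[n]$. For $w\in\mathbb{R}^n$ put $w(A)=\sum_{k\in A}w_k$. The base polytope is $B(F)=\{w\in\mathbb{R}^n: w(A)\le F(A)\ \forall A\subseteq[n],\ w([n])=F([n])\}$, with vertex set $\mathrm{vert}(B(F))$. The Lovász extension is $f(x)=\max_{w\in B(F)}w^\top x$. A function $g$ is $\alpha$-strongly convex ($\alpha>0$) if $g-\frac{\alpha}{2}\|\cdot\|_2^2$ is convex; strongly convex means this for some $\alpha>0$. Algorithm L-KM (Limited Memory Kelley's Method) for minimizing $g+f$ over $\mathbb{R}^n$ with tolerance $\epsilon\ge 0$: choose a nonempty affinely independent set $\mathcal{V}^{(0)}\subseteq\mathrm{vert}(B(F))$.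 For $i=1,2,\dots$: (1) let $f_{(i)}(x)=\max\{w^\top x: w\in\mathcal{V}^{(i-1)}\}$ and let $x^{(i)}$ be the (unique) minimizer of $g+f_{(i)}$ over $\mathbb{R}^n$; (2) choose a vertex $v^{(i)}\in\mathrm{vert}(B(F))$ with $v^{(i)}\in\operatorname{argmax}_{w\in B(F)}w^\top x^{(i)}$, so $f(x^{(i)})=(v^{(i)})^\top x^{(i)}$; (3) let $p^{(i)}=g(x^{(i)})+f(x^{(i)})$, $d^{(i)}=g(x^{(i)})+f_{(i)}(x^{(i)})$; stop and return $x^{(i)}$ if $p^{(i)}-d^{(i)}\le\epsilon$; (4) otherwise let $\mathcal{A}^{(i)}=\{w\in\mathcal{V}^{(i-1)}: w^\top x^{(i)}=f_{(i)}(x^{(i)})\}$ and $\mathcal{V}^{(i)}=\mathcal{A}^{(i)}\cup\{v^{(i)}\}$. *)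

theory Defs
  imports "HOL-Analysis.Analysis"
begin

text \<open>The ground set \<open>[n]\<close> is the index type \<open>'n\<close>, so that \<open>\<real>\<^sup>n\<close> is \<open>real ^ 'n\<close> and
  subsets of \<open>[n]\<close> are terms of type \<open>'n set\<close>.\<close>

definition submodular :: "('n::finite set \<Rightarrow> real) \<Rightarrow> bool" where
  "submodular F \<longleftrightarrow> (\<forall>A B. F A + F B \<ge> F (A \<union> B) + F (A \<inter> B))"

definition base_polytope :: "('n::finite set \<Rightarrow> real) \<Rightarrow> (real ^ 'n) set" where
  "base_polytope F = {w. (\<forall>A. (\<Sum>k\<in>A. w $ k) \<le> F A) \<and> (\<Sum>k\<in>UNIV. w $ k) = F UNIV}"

definition base_vertices :: "('n::finite set \<Rightarrow> real) \<Rightarrow> (real ^ 'n) set" where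
  "base_vertices F = {v. v extreme_point_of base_polytope F}"

text \<open>The base polytope of a submodular \<open>F\<close> with \<open>F {} = 0\<close> is nonempty and compact, so
  the supremum below is a maximum.\<close>

definition lovasz :: "('n::finite set \<Rightarrow> real) \<Rightarrow> real ^ 'n \<Rightarrow> real" where
  "lovasz F x = (SUP w\<in>base_polytope F. w \<bullet> x)"

definition strongly_convex :: "('a::real_inner \<Rightarrow> real) \<Rightarrow> bool" where
  "strongly_convex g \<longleftrightarrow> (\<exists>\<alpha>>0. convex_on UNIV (\<lambda>x. g x - \<alpha> / 2 * (norm x)\<^sup>2))"

definition unique_minimizer :: "('a \<Rightarrow> real) \<Rightarrow> 'a \<Rightarrow> bool" where
  "unique_minimizer h x \<longleftrightarrow> (\<forall>y. is_arg_min h (\<lambda>_. True) y \<longleftrightarrow> y = x)"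

text \<open>The piecewise linear lower model of the Lovasz extension given by a finite nonempty
  set \<open>V\<close> of vertices; \<open>f\<^sub>(\<^sub>i\<^sub>)\<close> is \<open>lower_model (V (i - 1))\<close>.\<close>

definition lower_model :: "(real ^ 'n::finite) set \<Rightarrow> real ^ 'n \<Rightarrow> real" where
  "lower_model V x = Max ((\<lambda>w. w \<bullet> x) ` V)"

definition primal_value ::
    "(real ^ 'n \<Rightarrow> real) \<Rightarrow> ('n::finite set \<Rightarrow> real) \<Rightarrow> real ^ 'n \<Rightarrow> real" where
  "primal_value g F x = g x + lovasz F x"

definition model_value ::
    "(real ^ 'n \<Rightarrow> real) \<Rightarrow> (real ^ 'n::finite) set \<Rightarrow> real ^ 'n \<Rightarrow> real" where
  "model_value g V x = g x + lower_model V x"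

text \<open>Affinely independent sets are finite, so no finiteness assumption is needed.\<close>

definition lkm_initial :: "('n::finite set \<Rightarrow> real) \<Rightarrow> (real ^ 'n) set \<Rightarrow> bool" where
  "lkm_initial F V \<longleftrightarrow> V \<noteq> {} \<and> V \<subseteq> base_vertices F \<and> \<not> affine_dependent V"

text \<open>Steps (1) and (2) of an iteration that starts from the vertex set \<open>V\<close>: the pair
  \<open>x\<close>, \<open>v\<close> is an admissible outcome.\<close>

definition lkm_iteration ::
    "(real ^ 'n \<Rightarrow> real) \<Rightarrow> ('n::finite set \<Rightarrow> real) \<Rightarrow> (real ^ 'n) set \<Rightarrow>
     real ^ 'n \<Rightarrow> real ^ 'n \<Rightarrow> bool" where
  "lkm_iteration g F V x v \<longleftrightarrow>
     unique_minimizer (model_value g V) x \<and>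
     v \<in> base_vertices F \<and> is_arg_max (\<lambda>w. w \<bullet> x) (\<lambda>w. w \<in> base_polytope F) v"

definition lkm_update ::
    "(real ^ 'n::finite) set \<Rightarrow> real ^ 'n \<Rightarrow> real ^ 'n \<Rightarrow> (real ^ 'n) set" where
  "lkm_update V x v = {w \<in> V. w \<bullet> x = lower_model V x} \<union> {v}"

text \<open>\<open>lkm_runs g F \<epsilon> V x v m\<close>: the sequences record an execution that has carried out
  iterations \<open>1, \<dots>, m\<close> without stopping in any of them, and hence goes on to iteration
  \<open>m + 1\<close> with the vertex set \<open>V m\<close>. The entries \<open>x 0\<close>, \<open>v 0\<close> and everything beyond index
  \<open>m\<close> are irrelevant.\<close>

definition lkm_runs ::
    "(real ^ 'n \<Rightarrow> real) \<Rightarrow> ('n::finite set \<Rightarrow> real) \<Rightarrow> real \<Rightarrow>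
     (nat \<Rightarrow> (real ^ 'n) set) \<Rightarrow> (nat \<Rightarrow> real ^ 'n) \<Rightarrow> (nat \<Rightarrow> real ^ 'n) \<Rightarrow> nat \<Rightarrow> bool" where
  "lkm_runs g F \<epsilon> V x v m \<longleftrightarrow>
     lkm_initial F (V 0) \<and>
     (\<forall>i\<in>{1..m}.
        lkm_iteration g F (V (i - 1)) (x i) (v i) \<and>
        \<not> primal_value g F (x i) - model_value g (V (i - 1)) (x i) \<le> \<epsilon> \<and>
        V i = lkm_update (V (i - 1)) (x i) (v i))"

definition lkm_stops_at ::
    "(real ^ 'n \<Rightarrow> real) \<Rightarrow> ('n::finite set \<Rightarrow> real) \<Rightarrow> real \<Rightarrow>
     (nat \<Rightarrow> (real ^ 'n) set) \<Rightarrow> (nat \<Rightarrow> real ^ 'n) \<Rightarrow> (nat \<Rightarrow> real ^ 'n) \<Rightarrow> nat \<Rightarrow> bool" where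
  "lkm_stops_at g F \<epsilon> V x v i \<longleftrightarrow>
     i \<ge> 1 \<and> lkm_runs g F \<epsilon> V x v (i - 1) \<and>
     lkm_iteration g F (V (i - 1)) (x i) (v i) \<and>
     primal_value g F (x i) - model_value g (V (i - 1)) (x i) \<le> \<epsilon>"

text \<open>Termination of the nondeterministic algorithm: it can be initialised, it never gets
  stuck (whenever it goes on to another iteration, the unique minimizer of step (1) and the
  vertex of step (2) exist), and no sequence of choices makes it run forever.\<close>

definition lkm_terminates ::
    "(real ^ 'n \<Rightarrow> real) \<Rightarrow> ('n::finite set \<Rightarrow> real) \<Rightarrow> real \<Rightarrow> bool" where
  "lkm_terminates g F \<epsilon> \<longleftrightarrow>
     (\<exists>V. lkm_initial F V) \<and>
     (\<forall>V x v m. lkm_runs g F \<epsilon> V x v m \<longrightarrow> (\<exists>y u. lkm_iteration g F (V m) y u)) \<and>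
     (\<nexists>V x v. \<forall>m. lkm_runs g F \<epsilon> V x v m)"

end

theory Submission
  imports Defs
begin

text \<open>The Lovasz extension is itself the lower model of the finite set of all vertices, so primal
  and model functions have the same shape \<open>g + max\<close> of linear functions, and each has a unique minimizer
  by strong convexity. Near \<open>x\<^sup>i\<close> only the active vertices \<open>A\<^sup>i\<close> matter, hence \<open>x\<^sup>i\<close> still minimizes
  the model over \<open>A\<^sup>i\<close>. If the algorithm does not stop, \<open>v\<^sup>i\<close> raises the model at \<open>x\<^sup>i\<close>, so the model
  minimum \<open>d\<^sup>i\<close> strictly increases. As \<open>d\<^sup>i\<close> is determined by the set \<open>V\<^bsup>i-1\<^esup>\<close> of vertices, no vertex
  set recurs, and there are only finitely many of them.\<close>

section \<open>Strong convexity and existence and uniqueness of minimizers\<close>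

lemma strongly_convex_add_convex:
  assumes "strongly_convex g" "convex_on UNIV q"
  shows "strongly_convex (\<lambda>x. g x + q x)"
proof -
  obtain \<alpha> where "\<alpha> > 0" "convex_on UNIV (\<lambda>x. g x - \<alpha> / 2 * (norm x)\<^sup>2)"
    using assms(1) unfolding strongly_convex_def by blast
  moreover from this have "convex_on UNIV (\<lambda>x. (g x - \<alpha> / 2 * (norm x)\<^sup>2) + q x)"
    using assms(2) by (intro convex_on_add) auto
  ultimately show ?thesis
    unfolding strongly_convex_def by (auto simp: algebra_simps)
qed

text \<open>Convexity of \<open>h\<close> minus the quadratic term leaves a slack of \<alpha>/2 * t
  * (1 - t) * \<open>(norm (x - y))\<^sup>2\<close>, which is positive for distinct points.\<close>

lemma strongly_convex_strict:
  assumes "strongly_convex h" "x \<noteq> y" "0 < t" "t < 1"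
  shows "h ((1 - t) *\<^sub>R x + t *\<^sub>R y) < (1 - t) * h x + t * h y"
proof -
  obtain \<alpha> where \<alpha>: "\<alpha> > 0" and cvx: "convex_on UNIV (\<lambda>x. h x - \<alpha> / 2 * (norm x)\<^sup>2)"
    using assms(1) unfolding strongly_convex_def by blast
  define z where "z = (1 - t) *\<^sub>R x + t *\<^sub>R y"
  have le: "h z - \<alpha> / 2 * (norm z)\<^sup>2
      \<le> (1 - t) * (h x - \<alpha> / 2 * (norm x)\<^sup>2) + t * (h y - \<alpha> / 2 * (norm y)\<^sup>2)"
    using convex_onD[OF cvx] assms(3,4) unfolding z_def by simp
  \<comment> \<open>Exact defect of the squared norm from affinity along the segment; this is the
    source of the slack.\<close>
  have "(norm z)\<^sup>2 = (1 - t) * (norm x)\<^sup>2 + t * (norm y)\<^sup>2 - t * (1 - t) * (norm (x - y))\<^sup>2"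
    unfolding power2_norm_eq_inner z_def
    by (simp add: inner_add_left inner_add_right inner_diff_left inner_diff_right inner_commute[of y x])
       (simp add: algebra_simps)
  with le have "h z \<le> (1 - t) * h x + t * h y - \<alpha> / 2 * (t * (1 - t) * (norm (x - y))\<^sup>2)"
    by (simp add: algebra_simps add_divide_distrib diff_divide_distrib)
  moreover have "\<alpha> / 2 * (t * (1 - t) * (norm (x - y))\<^sup>2) > 0"
    using \<alpha> assms by simp
  ultimately show ?thesis unfolding z_def by linarith
qed

lemma strongly_convex_minimizer_unique:
  assumes "strongly_convex h" "is_arg_min h (\<lambda>_. True) x"
  shows "unique_minimizer h x"
  unfolding unique_minimizer_def
proof (intro allI iffI)
  fix y assume y: "is_arg_min h (\<lambda>_. True) y"
  show "y = x"
  proof (rule ccontr)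
    assume "y \<noteq> x"
    then have "h ((1 - 1/2) *\<^sub>R y + (1/2) *\<^sub>R x) < (1 - 1/2) * h y + 1/2 * h x"
      by (intro strongly_convex_strict assms) auto
    also have "h x \<le> h y"
      using assms(2) by (simp add: is_arg_min_linorder)
    also have "\<dots> \<le> h ((1 - 1/2) *\<^sub>R y + (1/2) *\<^sub>R x)"
      using y by (simp add: is_arg_min_linorder)
    finally show False by (simp add: field_simps)
  qed
qed (use assms in simp)

lemma unique_minimizer_le: "unique_minimizer h x \<Longrightarrow> (h x :: real) \<le> h y"
  unfolding unique_minimizer_def is_arg_min_linorder by blast

text \<open>A convex function decreases at most linearly: \<open>q\<close> is bounded below on the
  unit ball by compactness, and the point of norm 1 on the segment from 0 to \<open>x\<close>
  transfers this bound to \<open>x\<close>.\<close>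

lemma convex_on_UNIV_lower_bound:
  fixes q :: "'a::euclidean_space \<Rightarrow> real"
  assumes "convex_on UNIV q"
  obtains C where "C > 0" "\<And>x. norm x \<ge> 1 \<Longrightarrow> q x \<ge> - C * norm x"
proof -
  have "continuous_on UNIV q"
    using assms convex_on_continuous open_UNIV by blast
  then obtain b where b: "\<And>y. y \<in> cball 0 1 \<Longrightarrow> q b \<le> q y"
    using continuous_attains_inf[of "cball 0 1" q] continuous_on_subset[of UNIV q "cball 0 1"]
    by fastforce
  \<comment> \<open>The summand 1 only serves to make the constant positive.\<close>
  have "q x \<ge> - (\<bar>q b\<bar> + \<bar>q 0\<bar> + 1) * norm x" if x: "norm x \<ge> 1" for x
  proof -
    let ?r = "norm x"
    have r: "?r > 0" using x by linarith
    have "q b \<le> q ((1 - 1 / ?r) *\<^sub>R 0 + (1 / ?r) *\<^sub>R x)"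
      using r by (intro b) simp
    also have "\<dots> \<le> (1 - 1 / ?r) * q 0 + 1 / ?r * q x"
      using x r by (intro convex_onD[OF assms]) auto
    finally have "?r * q b \<le> ?r * ((1 - 1 / ?r) * q 0 + 1 / ?r * q x)"
      using r by (intro mult_left_mono) auto
    also have "\<dots> = (?r - 1) * q 0 + q x"
      using r by (simp add: field_simps)
    finally have q: "?r * q b - (?r - 1) * q 0 \<le> q x" by linarith
    have qb: "?r * - \<bar>q b\<bar> \<le> ?r * q b"
      using r by (intro mult_left_mono) auto
    have "(?r - 1) * q 0 \<le> (?r - 1) * \<bar>q 0\<bar>"
      using x by (intro mult_left_mono) auto
    also have "\<dots> \<le> ?r * \<bar>q 0\<bar>"
      by (intro mult_right_mono) auto
    finally have q0: "(?r - 1) * q 0 \<le> ?r * \<bar>q 0\<bar>" .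
    have "- (\<bar>q b\<bar> + \<bar>q 0\<bar> + 1) * ?r = ?r * - \<bar>q b\<bar> - ?r * \<bar>q 0\<bar> - ?r"
      by (simp add: algebra_simps)
    also have "\<dots> \<le> ?r * - \<bar>q b\<bar> - ?r * \<bar>q 0\<bar>" by simp
    also have "\<dots> \<le> ?r * q b - (?r - 1) * q 0" by (intro diff_mono qb q0)
    also note q
    finally show ?thesis .
  qed
  then show thesis by (intro that[of "\<bar>q b\<bar> + \<bar>q 0\<bar> + 1"]) auto
qed

text \<open>The quadratic term outweighs the linear lower bound of the convex remainder, so far from
  the origin \<open>h\<close> is at least \<open>h 0\<close>. A minimizer over a large ball is
  therefore global.\<close>

lemma strongly_convex_ex_unique_minimizer:
  fixes h :: "'a::euclidean_space \<Rightarrow> real"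
  assumes "strongly_convex h"
  shows "\<exists>x. unique_minimizer h x"
proof -
  obtain \<alpha> where \<alpha>: "\<alpha> > 0" and cvx: "convex_on UNIV (\<lambda>x. h x - \<alpha> / 2 * (norm x)\<^sup>2)"
    using assms unfolding strongly_convex_def by blast
  obtain C where C: "C > 0" "\<And>x. norm x \<ge> 1 \<Longrightarrow> h x - \<alpha> / 2 * (norm x)\<^sup>2 \<ge> - C * norm x"
    using convex_on_UNIV_lower_bound[OF cvx] by blast
  have "continuous_on UNIV (\<lambda>x. h x - \<alpha> / 2 * (norm x)\<^sup>2)"
    using cvx convex_on_continuous open_UNIV by blast
  then have "continuous_on UNIV (\<lambda>x. (h x - \<alpha> / 2 * (norm x)\<^sup>2) + \<alpha> / 2 * (norm x)\<^sup>2)"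
    by (rule continuous_on_add) (intro continuous_intros)
  then have cont: "continuous_on UNIV h"
    by (simp only: diff_add_cancel)
  \<comment> \<open>Beyond radius \<open>R\<close>, the factor \<alpha>/2 * \<open>norm y\<close> -
    \<open>C\<close> is at least \<open>\<bar>h 0\<bar>\<close>. The maximum with 1 ensures that the
    linear bound applies and that multiplying by \<open>norm y\<close> preserves the
    estimate.\<close>
  define R where "R = max 1 (2 * (C + \<bar>h 0\<bar>) / \<alpha>)"
  then have "R \<ge> 1" by simp
  obtain x where x: "\<And>y. y \<in> cball 0 R \<Longrightarrow> h x \<le> h y"
    using continuous_attains_inf[of "cball 0 R" h] continuous_on_subset[OF cont, of "cball 0 R"]
      \<open>R \<ge> 1\<close> by fastforce
  have "h x \<le> h y" for y
  proof (cases "norm y \<le> R")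
    case False
    then have y: "norm y \<ge> 1" "norm y \<ge> 2 * (C + \<bar>h 0\<bar>) / \<alpha>" by (auto simp: R_def)
    then have "\<alpha> / 2 * norm y \<ge> C + \<bar>h 0\<bar>" using \<alpha> by (simp add: field_simps)
    then have "(\<alpha> / 2 * norm y - C) * norm y \<ge> \<bar>h 0\<bar> * 1"
      using y(1) by (intro mult_mono) auto
    moreover have "h x \<le> h 0" using R_def by (intro x) simp
    ultimately show ?thesis using C(2)[OF y(1)] by (simp add: algebra_simps power2_eq_square)
  qed (simp add: x)
  then have "is_arg_min h (\<lambda>_. True) x" by (simp add: is_arg_min_linorder)
  then show ?thesis using strongly_convex_minimizer_unique[OF assms] by blast
qed

section \<open>Geometry of the base polytope\<close>

text \<open>Greedy construction: elements are added one at a time, each receiving its marginal value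
  \<open>F (insert j S) - F S\<close> as coordinate.\<close>

lemma base_polytope_nonempty:
  fixes F :: "'n::finite set \<Rightarrow> real"
  assumes "submodular F" "F {} = 0"
  shows "base_polytope F \<noteq> {}"
proof -
  have "\<exists>w :: real ^ 'n. (\<forall>A\<subseteq>S. (\<Sum>k\<in>A. w $ k) \<le> F A) \<and> (\<Sum>k\<in>S. w $ k) = F S" for S :: "'n set"
  proof (induction S rule: finite_induct[OF finite])
    case 1
    then show ?case using assms(2) by simp
  next
    case (2 j S)
    then obtain w :: "real ^ 'n" where w: "\<And>A. A \<subseteq> S \<Longrightarrow> (\<Sum>k\<in>A. w $ k) \<le> F A"
      "(\<Sum>k\<in>S. w $ k) = F S" by blast
    define u :: "real ^ 'n" where "u = (\<chi> k. if k = j then F (insert j S) - F S else w $ k)"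
    have u_w: "(\<Sum>k\<in>A. u $ k) = (\<Sum>k\<in>A. w $ k)" if "A \<subseteq> S" for A
      using that 2(2) by (intro sum.cong) (auto simp: u_def)
    have u_insert: "(\<Sum>k\<in>insert j A. u $ k) = F (insert j S) - F S + (\<Sum>k\<in>A. w $ k)"
      if "A \<subseteq> S" for A
    proof -
      have "j \<notin> A" using that 2(2) by blast
      then have "(\<Sum>k\<in>insert j A. u $ k) = u $ j + (\<Sum>k\<in>A. u $ k)" by simp
      then show ?thesis using u_w[OF that] by (simp add: u_def)
    qed
    have "(\<Sum>k\<in>A. u $ k) \<le> F A" if A: "A \<subseteq> insert j S" for A
    proof (cases "j \<in> A")
      case True
      have sub: "A - {j} \<subseteq> S" using A by blast
      \<comment> \<open>Diminishing returns: for a set \<open>A\<close> containing \<open>j\<close>,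
        the marginal value of \<open>j\<close> over \<open>S\<close> is at most that over
        \<open>A - {j}\<close>.\<close>
      have "F A + F S \<ge> F (A \<union> S) + F (A \<inter> S)"
        using assms(1) unfolding submodular_def by blast
      moreover have "A \<union> S = insert j S" "A \<inter> S = A - {j}" using A True 2(2) by auto
      ultimately show ?thesis using u_insert[OF sub] w(1)[OF sub] True by (simp add: insert_absorb)
    next
      case False
      then show ?thesis using A u_w[of A] w(1)[of A] by (simp add: subset_insert)
    qed
    moreover have "(\<Sum>k\<in>insert j S. u $ k) = F (insert j S)"
      using u_insert[of S] w(2) by simp
    ultimately show ?case by blast
  qed
  from this[of UNIV] show ?thesis unfolding base_polytope_def by auto
qed

lemma sum_nth_eq_inner: "(\<Sum>k\<in>A. w $ k) = (\<chi> k. if k \<in> A then 1 else 0) \<bullet> (w :: real ^ 'n::finite)"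
  unfolding inner_vec_def by (auto simp: if_distrib if_distribR sum.If_cases cong: if_cong)

lemma polyhedron_base_polytope: "polyhedron (base_polytope F)"
proof -
  have "base_polytope F = (\<Inter>A. {w. (\<chi> k. if k \<in> A then 1 else 0) \<bullet> w \<le> F A})
      \<inter> {w. (\<chi> k. if k \<in> UNIV then 1 else 0) \<bullet> w = F UNIV}"
    unfolding base_polytope_def sum_nth_eq_inner by auto
  then show ?thesis
    by (auto intro!: polyhedron_Int polyhedron_Inter polyhedron_halfspace_le polyhedron_hyperplane)
qed

text \<open>The constraint for \<open>{k}\<close> bounds a coordinate from above; the constraint for
  its complement, with the fixed total, bounds it from below.\<close>

lemma bounded_base_polytope: "bounded (base_polytope F)"
proof -
  define c where "c k = max \<bar>F {k}\<bar> \<bar>F UNIV - F (UNIV - {k})\<bar>" for k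
  have "norm w \<le> (\<Sum>k\<in>UNIV. c k)" if w: "w \<in> base_polytope F" for w
  proof -
    have "\<bar>w $ k\<bar> \<le> c k" for k
    proof -
      have le: "(\<Sum>k\<in>A. w $ k) \<le> F A" for A using w by (simp add: base_polytope_def)
      have "(\<Sum>k\<in>UNIV. w $ k) = w $ k + (\<Sum>k\<in>UNIV - {k}. w $ k)"
        by (simp add: sum.remove)
      then have lower: "w $ k \<ge> F UNIV - F (UNIV - {k})"
        using w le[of "UNIV - {k}"] unfolding base_polytope_def mem_Collect_eq by linarith
      then show ?thesis using le[of "{k}"] by (auto simp: c_def)
    qed
    then show ?thesis by (intro order_trans[OF norm_le_l1_cart] sum_mono)
  qed
  then show ?thesis unfolding bounded_iff by blast
qed

lemma compact_base_polytope: "compact (base_polytope F)"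
  using polyhedron_base_polytope bounded_base_polytope
  by (metis compact_eq_bounded_closed polyhedron_imp_closed)

lemma finite_base_vertices: "finite (base_vertices F)"
  unfolding base_vertices_def using polyhedron_base_polytope by (rule finite_polyhedron_extreme_points)

lemma base_vertices_subset: "base_vertices F \<subseteq> base_polytope F"
  unfolding base_vertices_def extreme_point_of_def by blast

text \<open>The maximizers form a nonempty compact face. Such a face has an extreme point, which is
  extreme in the whole polytope as well.\<close>

lemma ex_arg_max_base_vertex:
  assumes "base_polytope F \<noteq> {}"
  shows "\<exists>v\<in>base_vertices F. is_arg_max (\<lambda>w. w \<bullet> x) (\<lambda>w. w \<in> base_polytope F) v"
proof -
  let ?B = "base_polytope F"
  obtain u where u: "u \<in> ?B" "\<And>w. w \<in> ?B \<Longrightarrow> w \<bullet> x \<le> u \<bullet> x"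
    using continuous_attains_sup[OF compact_base_polytope assms, of "\<lambda>w. w \<bullet> x"]
      continuous_on_inner[OF continuous_on_id continuous_on_const] by blast
  let ?T = "?B \<inter> {w. x \<bullet> w = u \<bullet> x}"
  have face: "?T face_of ?B"
    by (rule face_of_Int_supporting_hyperplane_le)
       (use u polyhedron_base_polytope[of F] in \<open>auto simp: inner_commute polyhedron_imp_convex\<close>)
  have "compact ?T" "convex ?T"
    using compact_base_polytope[of F] polyhedron_imp_convex[OF polyhedron_base_polytope[of F]]
    by (auto intro: compact_Int_closed closed_hyperplane convex_Int convex_hyperplane)
  moreover have "u \<in> ?T" using u by (simp add: inner_commute)
  ultimately obtain v where "v extreme_point_of ?T"
    using extreme_point_exists_convex by (metis empty_iff)
  with face have "v \<in> base_vertices F" "v \<in> ?T"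
    by (auto simp: base_vertices_def extreme_point_of_face)
  with u show ?thesis by (intro bexI[of _ v]) (auto simp: is_arg_max_linorder inner_commute)
qed

section \<open>Lower models and their active sets\<close>

text \<open>Makes the primal objective a model value over all vertices, so that every fact about
  models also covers it.\<close>

lemma lovasz_eq_lower_model:
  assumes "base_polytope F \<noteq> {}"
  shows "lovasz F = lower_model (base_vertices F)"
proof
  fix x
  obtain v where v: "v \<in> base_vertices F" "v \<in> base_polytope F"
    and max: "\<And>w. w \<in> base_polytope F \<Longrightarrow> w \<bullet> x \<le> v \<bullet> x"
    using ex_arg_max_base_vertex[OF assms, of x] by (auto simp: is_arg_max_linorder)
  have "lovasz F x = v \<bullet> x"
    unfolding lovasz_def using v max by (intro cSup_eq_maximum) auto
  moreover have "lower_model (base_vertices F) x = v \<bullet> x"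
    unfolding lower_model_def using v max base_vertices_subset[of F] finite_base_vertices[of F]
    by (intro Max_eqI) auto
  ultimately show "lovasz F x = lower_model (base_vertices F) x" by simp
qed

lemma lower_model_mono:
  assumes "finite W" "V \<noteq> {}" "V \<subseteq> W"
  shows "lower_model V x \<le> lower_model W x"
  unfolding lower_model_def using assms by (intro Max_mono) auto

lemma convex_lower_model:
  assumes "finite V" "V \<noteq> {}"
  shows "convex_on UNIV (lower_model V)"
proof (rule convex_onI)
  fix t :: real and x y :: "real ^ 'a" assume t: "0 < t" "t < 1"
  have "w \<bullet> ((1 - t) *\<^sub>R x + t *\<^sub>R y) \<le> (1 - t) * lower_model V x + t * lower_model V y"
    if "w \<in> V" for w
  proof -
    have "w \<bullet> x \<le> lower_model V x" "w \<bullet> y \<le> lower_model V y"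
      unfolding lower_model_def using assms that by auto
    then have "(1 - t) * (w \<bullet> x) + t * (w \<bullet> y) \<le> (1 - t) * lower_model V x + t * lower_model V y"
      using t by (intro add_mono mult_left_mono) auto
    then show ?thesis by (simp add: inner_add_right)
  qed
  then show "lower_model V ((1 - t) *\<^sub>R x + t *\<^sub>R y) \<le> (1 - t) * lower_model V x + t * lower_model V y"
    using assms by (subst lower_model_def) simp
qed simp

lemma strongly_convex_model_value:
  assumes "strongly_convex g" "finite V" "V \<noteq> {}"
  shows "strongly_convex (model_value g V)"
  unfolding model_value_def
  using strongly_convex_add_convex[OF assms(1) convex_lower_model[OF assms(2,3)]] .

lemma active_set_nonempty:
  assumes "finite V" "V \<noteq> {}"
  shows "{w \<in> V. w \<bullet> x = lower_model V x} \<noteq> {}"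
proof -
  have "Max ((\<lambda>w. w \<bullet> x) ` V) \<in> (\<lambda>w. w \<bullet> x) ` V"
    using assms by (intro Max_in) auto
  then show ?thesis unfolding lower_model_def by auto
qed

lemma lower_model_active_set:
  assumes "finite V" "V \<noteq> {}"
  shows "lower_model {w \<in> V. w \<bullet> x = lower_model V x} x = lower_model V x"
  using active_set_nonempty[OF assms, of x] assms(1)
  by (subst lower_model_def) (auto intro!: Max_eqI)

text \<open>Dropping the inactive vertices keeps \<open>x\<close> the strict minimizer. Otherwise a
  short move from \<open>x\<close> towards a competitor \<open>y\<close> would, by strict convexity,
  push the active model below its value at \<open>x\<close>; close to \<open>x\<close> the full
  model does not exceed the active one, so the minimality of \<open>x\<close> is violated.\<close>

lemma active_model_value_gt:
  assumes g: "strongly_convex g" and V: "finite V" "V \<noteq> {}"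
    and x: "unique_minimizer (model_value g V) x" and "y \<noteq> x"
  shows "model_value g {w \<in> V. w \<bullet> x = lower_model V x} y > model_value g V x"
proof (rule ccontr)
  define A where "A = {w \<in> V. w \<bullet> x = lower_model V x}"
  define z where "z t = (1 - t) *\<^sub>R x + t *\<^sub>R y" for t
  assume "\<not> ?thesis"
  then have le: "model_value g A y \<le> model_value g V x" by (simp add: A_def)
  have A: "finite A" "A \<noteq> {}" using V active_set_nonempty by (auto simp: A_def)
  have A_x: "model_value g A x = model_value g V x"
    using lower_model_active_set[OF V] by (simp add: model_value_def A_def)
  obtain a where a: "a \<in> A" using A by blast
  \<comment> \<open>An inactive \<open>w\<close> lies strictly below the active \<open>a\<close> at
    \<open>x\<close>, and by continuity still does so for small positive \<open>t\<close>.\<close>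
  have "\<forall>\<^sub>F t in at_right 0. w \<bullet> z t \<le> lower_model A (z t)" if "w \<in> V" for w
  proof (cases "w \<in> A")
    case True
    then show ?thesis using A by (auto simp: lower_model_def)
  next
    case False
    have "w \<bullet> x \<le> lower_model V x" using V that by (simp add: lower_model_def)
    then have less: "w \<bullet> x < a \<bullet> x" using False that a by (simp add: A_def order_less_le)
    have "((\<lambda>t. w \<bullet> z t - a \<bullet> z t) \<longlongrightarrow> w \<bullet> ((1 - 0) *\<^sub>R x + 0 *\<^sub>R y) - a \<bullet> ((1 - 0) *\<^sub>R x + 0 *\<^sub>R y)) (at_right 0)"
      unfolding z_def by (intro tendsto_intros)
    then have "\<forall>\<^sub>F t in at_right 0. w \<bullet> z t - a \<bullet> z t < 0"
      by (rule order_tendstoD) (use less in simp)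
    then show ?thesis
    proof (rule eventually_mono)
      fix t assume "w \<bullet> z t - a \<bullet> z t < 0"
      then have "w \<bullet> z t < a \<bullet> z t" by simp
      also have "\<dots> \<le> lower_model A (z t)" using A a by (simp add: lower_model_def)
      finally show "w \<bullet> z t \<le> lower_model A (z t)" by simp
    qed
  qed
  \<comment> \<open>Since \<open>V\<close> is finite, one \<open>t\<close> works for all vertices at
    once.\<close>
  then have "\<forall>\<^sub>F t in at_right 0. \<forall>w\<in>V. w \<bullet> z t \<le> lower_model A (z t)"
    using V by (simp add: eventually_ball_finite)
  moreover have "\<forall>\<^sub>F t in at_right 0. 0 < t \<and> t < (1::real)"
    using eventually_at_right_real[of 0 1] by (simp add: conj_commute)
  ultimately have "\<forall>\<^sub>F t in at_right 0. (\<forall>w\<in>V. w \<bullet> z t \<le> lower_model A (z t)) \<and> 0 < t \<and> t < 1"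
    by (rule eventually_conj)
  then obtain t where t: "\<And>w. w \<in> V \<Longrightarrow> w \<bullet> z t \<le> lower_model A (z t)" "0 < t" "t < 1"
    using eventually_happens'[OF trivial_limit_at_right_real] by blast
  have "model_value g V (z t) \<le> model_value g A (z t)"
    using V t(1) by (simp add: model_value_def lower_model_def[of V])
  also have "\<dots> < (1 - t) * model_value g A x + t * model_value g A y"
    unfolding z_def using \<open>y \<noteq> x\<close> t
    by (intro strongly_convex_strict strongly_convex_model_value g A) auto
  also have "\<dots> \<le> (1 - t) * model_value g V x + t * model_value g V x"
    using le A_x t by (intro add_mono mult_left_mono) auto
  also have "\<dots> = model_value g V x" by (simp add: algebra_simps)
  also have "\<dots> \<le> model_value g V (z t)"
    using x by (rule unique_minimizer_le)
  finally show False by simp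
qed

section \<open>Progress and finiteness of runs\<close>

lemma lkm_update_properties:
  assumes "V \<subseteq> base_vertices F" "lkm_iteration g F V x v"
  shows "lkm_update V x v \<noteq> {}" "lkm_update V x v \<subseteq> base_vertices F"
  using assms by (auto simp: lkm_update_def lkm_iteration_def)

text \<open>At \<open>x\<close> itself the new vertex \<open>v\<close> attains the Lovasz extension,
  and the gap makes the value rise. At any other point the retained active vertices already suffice.
  As \<open>y\<close> is arbitrary, the bound holds in particular at the next minimizer.\<close>

lemma lkm_update_model_value_gt:
  assumes g: "strongly_convex g" and V: "finite V" "V \<noteq> {}"
    and it: "lkm_iteration g F V x v"
    and gap: "primal_value g F x > model_value g V x"
  shows "model_value g (lkm_update V x v) y > model_value g V x"
proof -
  define A where "A = {w \<in> V. w \<bullet> x = lower_model V x}"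
  have fin: "finite (lkm_update V x v)" using V by (simp add: lkm_update_def)
  have A: "finite A" "A \<noteq> {}" "A \<subseteq> lkm_update V x v"
    using V active_set_nonempty by (auto simp: A_def lkm_update_def)
  show ?thesis
  proof (cases "y = x")
    case True
    have v: "v \<in> base_polytope F" "\<And>w. w \<in> base_polytope F \<Longrightarrow> w \<bullet> x \<le> v \<bullet> x"
      using it by (auto simp: lkm_iteration_def is_arg_max_linorder)
    then have "lovasz F x \<le> v \<bullet> x"
      unfolding lovasz_def by (intro cSUP_least) auto
    also have "\<dots> \<le> lower_model (lkm_update V x v) x"
      using fin by (simp add: lower_model_def lkm_update_def)
    finally show ?thesis using gap True by (simp add: primal_value_def model_value_def)
  next
    case False
    then have "model_value g V x < model_value g A y"
      unfolding A_def using it by (intro active_model_value_gt g V) (auto simp: lkm_iteration_def)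
    also have "\<dots> \<le> model_value g (lkm_update V x v) y"
      using lower_model_mono[OF fin A(2,3)] by (simp add: model_value_def)
    finally show ?thesis .
  qed
qed

lemma lkm_runs_Suc:
  "lkm_runs g F \<epsilon> V x v (Suc m) \<longleftrightarrow>
     lkm_runs g F \<epsilon> V x v m \<and> lkm_iteration g F (V m) (x (Suc m)) (v (Suc m)) \<and>
     \<not> primal_value g F (x (Suc m)) - model_value g (V m) (x (Suc m)) \<le> \<epsilon> \<and>
     V (Suc m) = lkm_update (V m) (x (Suc m)) (v (Suc m))"
  unfolding lkm_runs_def by (auto simp: atLeastAtMostSuc_conv)

text \<open>The invariant of a run: nonemptiness and inclusion in a finite set give meaning to the
  \<open>Max\<close> in \<open>lower_model\<close>, and inclusion confines all vertex sets to a
  finite power set.\<close>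

lemma lkm_runs_vertices:
  assumes "lkm_runs g F \<epsilon> V x v m"
  shows "V m \<noteq> {} \<and> V m \<subseteq> base_vertices F"
  using assms
proof (induction m)
  case 0
  then show ?case by (simp add: lkm_runs_def lkm_initial_def)
next
  case (Suc m)
  then have "V m \<noteq> {} \<and> V m \<subseteq> base_vertices F" by (simp add: lkm_runs_Suc)
  moreover have "lkm_iteration g F (V m) (x (Suc m)) (v (Suc m))"
    "V (Suc m) = lkm_update (V m) (x (Suc m)) (v (Suc m))"
    using Suc.prems by (simp_all add: lkm_runs_Suc)
  ultimately show ?case using lkm_update_properties by metis
qed

lemma lkm_runs_finite:
  assumes g: "strongly_convex g" and "\<epsilon> \<ge> 0" and runs: "\<And>m. lkm_runs g F \<epsilon> V x v m"
  shows False
proof -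
  define d where "d i = model_value g (V i) (x (Suc i))" for i
  have V: "V i \<noteq> {}" "V i \<subseteq> base_vertices F" "finite (V i)" for i
    using lkm_runs_vertices[OF runs, of i] finite_base_vertices finite_subset by blast+
  \<comment> \<open>Not stopping with a nonnegative tolerance means a strictly positive gap.\<close>
  have step: "lkm_iteration g F (V i) (x (Suc i)) (v (Suc i))"
    "primal_value g F (x (Suc i)) > model_value g (V i) (x (Suc i))"
    "V (Suc i) = lkm_update (V i) (x (Suc i)) (v (Suc i))" for i
    using runs[of "Suc i"] \<open>\<epsilon> \<ge> 0\<close> by (auto simp: lkm_runs_Suc)
  have "d i < d (Suc i)" for i
    unfolding d_def step(3)[of i] by (rule lkm_update_model_value_gt[OF g V(3,1) step(1,2)])
  then have "strict_mono d" by (simp add: strict_mono_Suc_iff)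
  \<comment> \<open>Equal vertex sets have the same unique model minimizer and hence the same value
    of \<open>d\<close>, which strict monotonicity allows only for equal indices.\<close>
  have "inj V"
  proof (rule injI)
    fix i j assume eq: "V i = V j"
    then have "x (Suc i) = x (Suc j)"
      using step(1)[of i] step(1)[of j] unfolding lkm_iteration_def unique_minimizer_def by metis
    with eq have "d i = d j" by (simp add: d_def)
    then show "i = j" using \<open>strict_mono d\<close> by (simp add: strict_mono_eq)
  qed
  moreover have "range V \<subseteq> Pow (base_vertices F)" using V by blast
  then have "finite (range V)" using finite_base_vertices finite_subset by blast
  ultimately show False using finite_imageD by auto
qed

theorem theorem3p5:
  fixes g :: "real ^ 'n::finite \<Rightarrow> real" and F :: "'n set \<Rightarrow> real" and \<epsilon> :: real
  assumes "strongly_convex g" and "submodular F" and "F {} = 0" and "\<epsilon> \<ge> 0"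
  shows "\<exists>pstar.
    (\<exists>x. primal_value g F x = pstar) \<and> (\<forall>x. pstar \<le> primal_value g F x) \<and>
    lkm_terminates g F \<epsilon> \<and>
    (\<forall>V x v i. lkm_stops_at g F \<epsilon> V x v i \<longrightarrow>
       (let p = primal_value g F (x i); d = model_value g (V (i - 1)) (x i)
        in pstar + \<epsilon> \<ge> p \<and> p \<ge> pstar \<and> pstar \<ge> d \<and> d \<ge> pstar - \<epsilon> \<and>
           (\<epsilon> = 0 \<longrightarrow> p = pstar \<and> pstar = d \<and> unique_minimizer (primal_value g F) (x i))))"
proof -
  note g = assms(1)
  let ?W = "base_vertices F"
  have B: "base_polytope F \<noteq> {}" using assms(2,3) by (rule base_polytope_nonempty)
  then have W: "finite ?W" "?W \<noteq> {}"
    using finite_base_vertices ex_arg_max_base_vertex by blast+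
  have primal: "primal_value g F = model_value g ?W"
    by (simp add: fun_eq_iff primal_value_def model_value_def lovasz_eq_lower_model[OF B])
  have sc: "strongly_convex (primal_value g F)"
    unfolding primal using g W by (rule strongly_convex_model_value)
  then obtain z where z: "unique_minimizer (primal_value g F) z"
    using strongly_convex_ex_unique_minimizer by blast
  have z_le: "primal_value g F z \<le> primal_value g F y" for y
    using z by (rule unique_minimizer_le)
  have "lkm_terminates g F \<epsilon>"
    unfolding lkm_terminates_def
  proof (intro conjI allI impI)
    show "\<exists>V. lkm_initial F V"
    proof -
      \<comment> \<open>A singleton is affinely independent, so any single vertex is an admissible
        start.\<close>
      obtain u where "u \<in> ?W" using W by blast
      then have "lkm_initial F {u}" by (simp add: lkm_initial_def)
      then show ?thesis ..
    qed
    show "\<exists>y u. lkm_iteration g F (V m) y u" if "lkm_runs g F \<epsilon> V x v m" for V x v m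
    proof -
      have "finite (V m)" "V m \<noteq> {}"
        using lkm_runs_vertices[OF that] W finite_subset by auto
      then obtain y where "unique_minimizer (model_value g (V m)) y"
        using strongly_convex_ex_unique_minimizer strongly_convex_model_value[OF g] by blast
      then show ?thesis
        using ex_arg_max_base_vertex[OF B, of y] by (auto simp: lkm_iteration_def)
    qed
    show "\<nexists>V x v. \<forall>m. lkm_runs g F \<epsilon> V x v m"
      using lkm_runs_finite[OF g assms(4)] by blast
  qed
  moreover have "let p = primal_value g F (x i); d = model_value g (V (i - 1)) (x i)
      in primal_value g F z + \<epsilon> \<ge> p \<and> p \<ge> primal_value g F z \<and> primal_value g F z \<ge> d \<and>
         d \<ge> primal_value g F z - \<epsilon> \<and>
         (\<epsilon> = 0 \<longrightarrow> p = primal_value g F z \<and> primal_value g F z = d \<and>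
            unique_minimizer (primal_value g F) (x i))"
    if stop: "lkm_stops_at g F \<epsilon> V x v i" for V x v i
  proof -
    have V: "V (i - 1) \<noteq> {}" "V (i - 1) \<subseteq> ?W"
      using stop lkm_runs_vertices unfolding lkm_stops_at_def by blast+
    have gap: "primal_value g F (x i) - model_value g (V (i - 1)) (x i) \<le> \<epsilon>"
      using stop by (simp add: lkm_stops_at_def)
    \<comment> \<open>Lower bound for the optimum: the model minimum is at most the model at
      \<open>z\<close>, and a maximum over fewer vertices lies below the Lovasz extension. With the
      stopping test this yields all four inequalities.\<close>
    have "model_value g (V (i - 1)) (x i) \<le> model_value g (V (i - 1)) z"
      using stop by (intro unique_minimizer_le) (simp add: lkm_stops_at_def lkm_iteration_def)
    also have "\<dots> \<le> primal_value g F z"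
      using lower_model_mono[OF W(1) V] by (simp add: primal model_value_def)
    finally have d: "model_value g (V (i - 1)) (x i) \<le> primal_value g F z" .
    have "unique_minimizer (primal_value g F) (x i)" if "\<epsilon> = 0"
    proof -
      \<comment> \<open>With zero tolerance the stopping test squeezes the primal value at
        \<open>x i\<close> down to the optimum.\<close>
      have "primal_value g F (x i) \<le> primal_value g F y" for y
        using z_le[of y] d gap that by linarith
      then show ?thesis
        by (intro strongly_convex_minimizer_unique[OF sc]) (simp add: is_arg_min_linorder)
    qed
    then show ?thesis using d gap z_le[of "x i"] by (auto simp: Let_def)
  qed
  ultimately show ?thesis
    using z_le by (intro exI[of _ "primal_value g F z"]) blast
qed

end
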